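(* Let $f:\mathrm{Gr}(k,n)\to\mathbb{R}$ be (the restriction of) a $C^1$ function defined on an open neighbourhood of $\mathrm{Gr}(k,n)$ in $\mathbb{R}^{n\times n}$, let $Q=VI_{k,n-k}V^{\mathsf T}\in\mathrm{Gr}(k,n)$ with $V\in\mathrm{O}(n)$, and let $f_Q:=\bigl[\frac{\partial f}{\partial q_{ij}}(Q)\bigr]_{i,j=1}^n\in\mathbb{R}^{n\times n}$. If we partition \[ V^{\mathsf T}(f_Q+f_Q^{\mathsf T})V=\begin{bmatrix}A & B \\ B^{\mathsf T} & C\end{bmatrix},\qquad A\in\mathbb{R}^{k\times k},\ B\in\mathbb{R}^{k\times(n-k)},\ C\in\mathbb{R}^{(n-k)\times(n-k)}, \] then the Riemannian gradient of $f$ at $Q$ is \[ \nabla f(Q)=\frac12V\begin{bmatrix}0 & B \\ B^{\mathsf T} & 0\end{bmatrix}V^{\mathsf T}. \]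
   Context: For $k\in\{1,\dots,n\}$, $\mathrm{Gr}(k,n)=\{Q\in\mathrm{O}(n):Q^{\mathsf T}=Q,\ \operatorname{tr}(Q)=2k-n\}$, an embedded submanifold of $\mathbb{R}^{n\times n}$, equipped with the Riemannian metric $\langle X,Y\rangle_Q=\operatorname{tr}(XY)$ for $X,Y\in\mathbb{T}_Q\mathrm{Gr}(k,n)$ (tangent vectors are symmetric matrices). $I_{k,n-k}=\operatorname{diag}(I_k,-I_{n-k})$. The partial derivatives are with respect to the $n^2$ entries $q_{ij}$ of a matrix in $\mathbb{R}^{n\times n}$. *)

theory Defs
  imports "Jordan_Normal_Form.Matrix" "HOL-Analysis.Analysis"
begin

type_synonym 'n sq_matrix = "((real, 'n) Finite_Cartesian_Product.vec, 'n) Finite_Cartesian_Product.vec"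

text \<open>
  Square matrices over the reals are elements of \<^typ>\<open>'n sq_matrix\<close>, that is \<^typ>\<open>real^'n^'n\<close>, so that the size is
  $n = $ \<open>CARD('n)\<close>.  The linear order on \<^typ>\<open>'n\<close> numbers rows and columns by
  $0, \dots, n - 1$; it is only needed to speak about leading blocks.  Blocks, whose
  sizes $k$ and $n - k$ are numbers (and $n - k$ may be 0), are matrices with explicit dimensions
  from \<^theory>\<open>Jordan_Normal_Form.Matrix\<close>.
\<close>

definition index_pos :: "'n::{finite,linorder} \<Rightarrow> nat" where
  "index_pos i = card {..<i}"

definition cart_of_mat :: "real mat \<Rightarrow> ('n::{finite,linorder}) sq_matrix" where
  "cart_of_mat M = (\<chi> i j. M $$ (index_pos i, index_pos j))"

definition signature_matrix :: "nat \<Rightarrow> ('n::{finite,linorder}) sq_matrix" where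
  "signature_matrix k =
     (let l = CARD('n) - k in
      cart_of_mat (four_block_mat (1\<^sub>m k) (0\<^sub>m k l) (0\<^sub>m l k) (- 1\<^sub>m l)))"

definition Gr :: "nat \<Rightarrow> (real^'n^'n) set" where
  "Gr k = {Q. orthogonal_matrix Q \<and> transpose Q = Q \<and>
              trace Q = 2 * real k - real CARD('n)}"

definition Gr_metric :: "real^'n^'n \<Rightarrow> real^'n^'n \<Rightarrow> real^'n^'n \<Rightarrow> real" where
  "Gr_metric Q X Y = trace (X ** Y)"

text \<open>
  Smooth curves $(-\varepsilon, \varepsilon) \to M$ through $p$ at time 0; the function
  \<open>D m\<close> is the \<open>m\<close>-th derivative of the curve on that interval.
\<close>

definition smooth_curve_through ::
    "'a::real_normed_vector set \<Rightarrow> 'a \<Rightarrow> (real \<Rightarrow> 'a) \<Rightarrow> bool" where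
  "smooth_curve_through M p \<gamma> \<longleftrightarrow>
     \<gamma> 0 = p \<and>
     (\<exists>\<epsilon>>0. \<gamma> ` {-\<epsilon><..<\<epsilon>} \<subseteq> M \<and>
        (\<exists>D. D 0 = \<gamma> \<and>
           (\<forall>m. \<forall>t\<in>{-\<epsilon><..<\<epsilon>}. (D m has_vector_derivative D (Suc m) t) (at t))))"

definition tangent_space :: "'a::real_normed_vector set \<Rightarrow> 'a \<Rightarrow> 'a set" where
  "tangent_space M p = {vector_derivative \<gamma> (at 0) |\<gamma>. smooth_curve_through M p \<gamma>}"

text \<open>
  \<open>G\<close> is the gradient at \<open>p\<close> of the restriction of \<open>f\<close> to \<open>M\<close> with respect to the metric \<open>g\<close>:
  a tangent vector with $g_p(G, X) = \mathrm{d}f_p(X)$ for all tangent vectors $X$, where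
  $\mathrm{d}f_p(X)$ is the derivative of $f$ along curves in $M$ with velocity $X$.
  Only the values of \<open>f\<close> on \<open>M\<close> matter.
\<close>

definition is_riemannian_gradient ::
    "'a::real_normed_vector set \<Rightarrow> ('a \<Rightarrow> 'a \<Rightarrow> 'a \<Rightarrow> real) \<Rightarrow> ('a \<Rightarrow> real) \<Rightarrow> 'a \<Rightarrow> 'a \<Rightarrow> bool"
  where
  "is_riemannian_gradient M g f p G \<longleftrightarrow>
     G \<in> tangent_space M p \<and>
     (\<forall>\<gamma>. smooth_curve_through M p \<gamma> \<longrightarrow>
        ((\<lambda>t. f (\<gamma> t)) has_real_derivative g p G (vector_derivative \<gamma> (at 0))) (at 0))"

definition continuously_differentiable_on ::
    "('a::real_normed_vector \<Rightarrow> 'b::real_normed_vector) \<Rightarrow> 'a set \<Rightarrow> bool" where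
  "continuously_differentiable_on f U \<longleftrightarrow>
     (\<exists>f' :: 'a \<Rightarrow> 'a \<Rightarrow>\<^sub>L 'b.
        (\<forall>x\<in>U. (f has_derivative blinfun_apply (f' x)) (at x)) \<and> continuous_on U f')"

definition partial_deriv_matrix :: "(real^'n^'n \<Rightarrow> real) \<Rightarrow> real^'n^'n \<Rightarrow> real^'n^'n" where
  "partial_deriv_matrix f Q = (\<chi> i j. deriv (\<lambda>t. f (Q + t *\<^sub>R axis i (axis j 1))) 0)"

end

theory Submission imports Defs begin

text \<open>
  With \<open>J\<close> the signature matrix, \<open>S = f\<^sub>Q + f\<^sub>Q\<^sup>T\<close> and \<open>M = V\<^sup>T S V\<close>, the off-diagonal part of \<open>M\<close> is
  \<open>(M - J M J) / 2\<close>, so the asserted gradient is \<open>G = (S - Q S Q) / 4\<close>. The tangent space at \<open>Q\<close> consists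
  of the symmetric \<open>X\<close> with \<open>Q X + X Q = 0\<close>. For such \<open>X\<close>, \<open>Q X Q = - X\<close> gives
  \<open>tr (G X) = tr (S X) / 2 = tr (f\<^sub>Q\<^sup>T X)\<close>, the derivative of \<open>f\<close> in the direction \<open>X\<close>. Uniqueness holds since
  the tangent space is linear and \<open>tr (X X) > 0\<close> for symmetric \<open>X \<noteq> 0\<close>.
\<close>

section \<open>Bilinearity of the product, transpose and trace\<close>

no_notation vec_index (infixl \<open>$\<close> 100)
no_notation scalar_prod (infix \<open>\<bullet>\<close> 70)

lemma bounded_bilinear_matrix_mult:
  "bounded_bilinear ((**) :: real^'n^'m \<Rightarrow> real^'p^'n \<Rightarrow> real^'p^'m)"
  unfolding bilinear_conv_bounded_bilinear [symmetric] bilinear_def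
  by (auto intro!: linearI
      simp: matrix_add_ldistrib matrix_matrix_mult_def vec_eq_iff algebra_simps
        sum.distrib sum_distrib_left)

interpretation matrix_mult:
  bounded_bilinear "(**) :: real^'n^'m \<Rightarrow> real^'p^'n \<Rightarrow> real^'p^'m"
  by (rule bounded_bilinear_matrix_mult)

lemma bounded_linear_transpose: "bounded_linear (transpose :: real^'n^'m \<Rightarrow> real^'m^'n)"
  unfolding linear_conv_bounded_linear [symmetric]
  by (auto intro!: linearI simp: transpose_def vec_eq_iff)

lemmas transpose_has_vector_derivative =
  bounded_linear.has_vector_derivative [OF bounded_linear_transpose]

lemma transpose_add: "transpose (A + B) = transpose A + transpose B"
  and transpose_diff: "transpose (A - B) = transpose A - transpose B"
  for A B :: "real^'n^'m"
  by (simp_all add: transpose_def vec_eq_iff)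

lemma trace_scaleR: "trace (c *\<^sub>R A) = c * trace (A :: real^'n^'n)"
  by (simp add: trace_def sum_distrib_left)

lemma trace_minus: "trace (- A) = - trace (A :: real^'n^'n)"
  by (simp add: trace_def sum_negf)

lemma trace_transpose: "trace (transpose A) = trace (A :: real^'n^'n)"
  by (simp add: trace_def transpose_def)

lemma trace_transpose_mult:
  "trace (transpose A ** B) = (\<Sum>i\<in>UNIV. \<Sum>j\<in>UNIV. A $ i $ j * B $ i $ j)"
  for A B :: "real^'n^'n"
  unfolding trace_def matrix_matrix_mult_def transpose_def
  by (subst sum.swap) simp

text \<open>For symmetric \<open>X\<close> the trace is the sum of the squared entries. This is the
  definiteness of the metric behind uniqueness of the gradient.\<close>

lemma symmetric_eq_0_if_trace_square:
  fixes X :: "real^'n^'n"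
  assumes "transpose X = X" "trace (X ** X) = 0"
  shows "X = 0"
proof -
  have "(\<Sum>i\<in>UNIV. \<Sum>j\<in>UNIV. X $ i $ j * X $ i $ j) = 0"
    using trace_transpose_mult[of X X] assms by simp
  then have "X $ i $ j * X $ i $ j = 0" for i j
    by (simp add: sum_nonneg_eq_0_iff sum_nonneg)
  then show ?thesis
    by (simp add: vec_eq_iff)
qed

subsection \<open>The exponential of a matrix\<close>

fun matrix_power :: "real^'n^'n \<Rightarrow> nat \<Rightarrow> real^'n^'n" where
  "matrix_power W 0 = Finite_Cartesian_Product.mat 1"
| "matrix_power W (Suc m) = matrix_power W m ** W"

text \<open>The sum \<open>?K\<close> of all absolute entries dominates every absolute column sum,
  so each further factor \<open>W\<close> costs at most a factor \<open>?K\<close>. This bounds the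
  entries of \<open>matrix_exp\<close> by a real exponential series.\<close>

lemma matrix_power_entry_le:
  "\<bar>matrix_power W m $ i $ j\<bar> \<le> (\<Sum>a\<in>UNIV. \<Sum>b\<in>UNIV. \<bar>W $ a $ b\<bar>) ^ m"
proof (induction m arbitrary: i j)
  case 0
  then show ?case by (simp add: Finite_Cartesian_Product.mat_def)
next
  case (Suc m)
  let ?K = "\<Sum>a\<in>UNIV. \<Sum>b\<in>UNIV. \<bar>W $ a $ b\<bar>"
  have "\<bar>matrix_power W (Suc m) $ i $ j\<bar>
      \<le> (\<Sum>l\<in>UNIV. \<bar>matrix_power W m $ i $ l\<bar> * \<bar>W $ l $ j\<bar>)"
    unfolding matrix_power.simps matrix_matrix_mult_def
    by (simp add: abs_mult [symmetric])
  also have "\<dots> \<le> (\<Sum>l\<in>UNIV. ?K ^ m * \<bar>W $ l $ j\<bar>)"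
    by (intro sum_mono mult_right_mono Suc.IH) auto
  also have "\<dots> = ?K ^ m * (\<Sum>l\<in>UNIV. \<bar>W $ l $ j\<bar>)"
    by (simp add: sum_distrib_left)
  also have "\<dots> \<le> ?K ^ m * ?K"
    by (intro mult_left_mono sum_mono zero_le_power sum_nonneg) (auto intro: member_le_sum)
  finally show ?case by (simp add: mult.commute)
qed

text \<open>Each entry is a real power series in \<open>t\<close>, so that termwise differentiation
  of real series applies.\<close>

definition matrix_exp :: "real^'n^'n \<Rightarrow> real \<Rightarrow> real^'n^'n" where
  "matrix_exp W t = (\<chi> i j. \<Sum>m. matrix_power W m $ i $ j / fact m * t ^ m)"

lemma summable_matrix_exp: "summable (\<lambda>m. matrix_power W m $ i $ j / fact m * t ^ m)"
proof (rule summable_comparison_test')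
  let ?K = "\<Sum>a\<in>UNIV. \<Sum>b\<in>UNIV. \<bar>W $ a $ b\<bar>"
  show "summable (\<lambda>m. inverse (fact m) * (?K * \<bar>t\<bar>) ^ m)"
    by (rule summable_exp)
  show "norm (matrix_power W m $ i $ j / fact m * t ^ m) \<le> inverse (fact m) * (?K * \<bar>t\<bar>) ^ m"
    if "m \<ge> 0" for m
    using mult_right_mono[OF matrix_power_entry_le[of W m i j], of "\<bar>t\<bar> ^ m / fact m"]
    by (simp add: abs_mult power_abs power_mult_distrib field_simps)
qed

lemma matrix_exp_0: "matrix_exp W 0 = Finite_Cartesian_Product.mat 1"
  by (simp add: matrix_exp_def vec_eq_iff powser_zero del: times_divide_eq_left)

text \<open>The factor \<open>W\<close> appears on the right because \<open>matrix_power\<close>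
  appends it there; on that side it meets the middle factor of a conjugate
  \<open>E ** Y ** transpose E\<close>.\<close>

lemma matrix_exp_has_vector_derivative:
  fixes W :: "real^'n^'n"
  shows "(matrix_exp W has_vector_derivative matrix_exp W t ** W) (at t)"
proof -
  have entry: "((\<lambda>s. \<Sum>m. matrix_power W m $ i $ j / fact m * s ^ m)
      has_vector_derivative (matrix_exp W t ** W) $ i $ j) (at t)" for i j
  proof -
    let ?c = "\<lambda>m. matrix_power W m $ i $ j / fact m"
    have "(\<lambda>m. \<Sum>l\<in>UNIV. matrix_power W m $ i $ l / fact m * t ^ m * W $ l $ j) sums
        (\<Sum>l\<in>UNIV. (\<Sum>m. matrix_power W m $ i $ l / fact m * t ^ m) * W $ l $ j)"
      by (intro sums_sum sums_mult2 summable_sums summable_matrix_exp)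
    \<comment> \<open>\<open>diffs\<close> shifts the index: (m + 1) / (m + 1)! = 1 / m!, and the
      power m + 1 of \<open>W\<close> splits off one factor \<open>W\<close>.\<close>
    moreover have "diffs ?c m * t ^ m
        = (\<Sum>l\<in>UNIV. matrix_power W m $ i $ l / fact m * t ^ m * W $ l $ j)" for m
      by (simp add: diffs_def matrix_matrix_mult_def sum_distrib_left sum_divide_distrib
          field_simps del: of_nat_Suc)
    ultimately have "(\<Sum>m. diffs ?c m * t ^ m) = (matrix_exp W t ** W) $ i $ j"
      by (simp add: sums_iff matrix_exp_def matrix_matrix_mult_def)
    then show ?thesis
      using termdiffs_strong_converges_everywhere[of ?c t, OF summable_matrix_exp]
      unfolding has_real_derivative_iff_has_vector_derivative by simp
  qed
  show ?thesis
    unfolding has_vector_derivative_def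
  proof (subst has_derivative_componentwise_within, rule ballI)
    fix b :: "real^'n^'n"
    assume "b \<in> Basis"
    then obtain i j where "b = axis i (axis j 1)"
      by (auto simp: Basis_vec_def)
    then show "((\<lambda>s. matrix_exp W s \<bullet> b) has_derivative
        (\<lambda>h. h *\<^sub>R (matrix_exp W t ** W) \<bullet> b)) (at t)"
      using entry[of i j]
      by (simp add: inner_axis has_vector_derivative_def matrix_exp_def)
  qed
qed

lemma constant_on_reals:
  fixes g :: "real \<Rightarrow> 'a::real_normed_vector"
  assumes "\<And>t. (g has_vector_derivative 0) (at t)"
  shows "g t = g 0"
  using has_vector_derivative_zero_constant[of UNIV g] assms
  by (metis UNIV_I convex_UNIV)

text \<open>With \<open>E = matrix_exp W t\<close>, the derivative of
  \<open>E ** transpose E\<close> is \<open>E ** (W + transpose W) ** transpose E = 0\<close>, so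
  the product keeps its value at \<open>t = 0\<close>, the identity.\<close>

lemma skew_matrix_exp_orthogonal:
  fixes W :: "real^'n^'n"
  assumes "transpose W = - W"
  shows "orthogonal_matrix (matrix_exp W t)"
proof -
  note D = matrix_exp_has_vector_derivative
  have "((\<lambda>t. matrix_exp W t ** transpose (matrix_exp W t)) has_vector_derivative 0) (at t)" for t
    using matrix_mult.has_vector_derivative
        [OF D[of W t] transpose_has_vector_derivative[OF D[of W t]]]
    by (simp add: matrix_transpose_mul assms matrix_mul_assoc matrix_mult.minus_left
        matrix_mult.minus_right)
  then have "matrix_exp W t ** transpose (matrix_exp W t)
      = matrix_exp W 0 ** transpose (matrix_exp W 0)"
    by (rule constant_on_reals)
  then show ?thesis
    by (simp add: matrix_exp_0 orthogonal_matrix_def matrix_left_right_inverse)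
qed

subsection \<open>Tangent spaces of the Grassmannian\<close>

lemma trace_conjugate_orthogonal:
  fixes E Q :: "real^'n^'n"
  assumes "orthogonal_matrix E"
  shows "trace (E ** Q ** transpose E) = trace Q"
  using assms trace_mul_sym[of "E ** Q" "transpose E"]
  by (simp add: matrix_mul_assoc orthogonal_matrix_def)

lemma Gr_conjugate_orthogonal:
  fixes E Q :: "real^'n^'n"
  assumes "orthogonal_matrix E" "Q \<in> Gr k"
  shows "E ** Q ** transpose E \<in> Gr k"
  using assms
  by (auto simp: Gr_def trace_conjugate_orthogonal matrix_transpose_mul matrix_mul_assoc
      intro!: orthogonal_matrix_mul)

lemma Gr_square: "Q \<in> Gr k \<Longrightarrow> Q ** Q = Finite_Cartesian_Product.mat 1"
  by (auto simp: Gr_def orthogonal_matrix_def)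

text \<open>Both constraints come from differentiating \<open>\<gamma>\<^sup>T = \<gamma>\<close> and \<open>\<gamma> \<gamma> = I\<close> at 0.\<close>

lemma Gr_velocity:
  fixes Q :: "real^'n^'n"
  assumes "smooth_curve_through (Gr k) Q \<gamma>" "Y = vector_derivative \<gamma> (at 0)"
  shows "(\<gamma> has_vector_derivative Y) (at 0)" "transpose Y = Y" "Q ** Y + Y ** Q = 0"
proof -
  from assms obtain \<epsilon> D where \<epsilon>: "\<epsilon> > 0" "\<gamma> ` {-\<epsilon><..<\<epsilon>} \<subseteq> Gr k" "D 0 = \<gamma>"
      and D: "\<forall>m. \<forall>t\<in>{-\<epsilon><..<\<epsilon>}. (D m has_vector_derivative D (Suc m) t) (at t)"
    and 0: "\<gamma> 0 = Q"
    unfolding smooth_curve_through_def by blast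
  have "(\<gamma> has_vector_derivative D 1 0) (at 0)"
    using D[rule_format, of 0 0] \<epsilon> by simp
  then show deriv: "(\<gamma> has_vector_derivative Y) (at 0)"
    by (simp add: assms(2) vector_derivative_at)
  have near: "\<gamma> t \<in> Gr k" if "t \<in> {-\<epsilon><..<\<epsilon>}" for t
    using \<epsilon>(2) that by blast
  have nhd: "open {-\<epsilon><..<\<epsilon>}" "0 \<in> {-\<epsilon><..<\<epsilon>}"
    using \<epsilon> by auto
  have "((\<lambda>t. transpose (\<gamma> t)) has_vector_derivative Y) (at 0)"
    by (rule has_vector_derivative_transform_within_open[OF deriv nhd])
      (use near in \<open>auto simp: Gr_def\<close>)
  then show "transpose Y = Y"
    using transpose_has_vector_derivative[OF deriv] vector_derivative_unique_at by blast
  have "((\<lambda>t. \<gamma> t ** \<gamma> t) has_vector_derivative 0) (at 0)"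
    by (rule has_vector_derivative_transform_within_open
        [OF has_vector_derivative_const[of "Finite_Cartesian_Product.mat 1"] nhd])
      (use near Gr_square in force)
  then show "Q ** Y + Y ** Q = 0"
    using matrix_mult.has_vector_derivative[OF deriv deriv] vector_derivative_unique_at 0
    by blast
qed

text \<open>The tangent vector \<open>X\<close> is the velocity of \<open>exp (t W) Q exp (t W)\<^sup>T\<close> with \<open>W = X Q / 2\<close>. All
  derivatives of this curve are explicit: they replace \<open>Q\<close> by iterated commutators with \<open>W\<close>.\<close>

lemma Gr_curve_exists:
  fixes Q X :: "real^'n^'n"
  assumes Q: "Q \<in> Gr k" and sym: "transpose X = X" and anti: "Q ** X + X ** Q = 0"
  obtains \<gamma> where "smooth_curve_through (Gr k) Q \<gamma>" "vector_derivative \<gamma> (at 0) = X"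
proof -
  \<comment> \<open>Since \<open>X\<close> anticommutes with the involution \<open>Q\<close>,
    \<open>W\<close> is skew, and \<open>W ** Q\<close> and \<open>Q ** W\<close> are
    \<open>X / 2\<close> and \<open>- X / 2\<close>; the factor 1/2 makes their difference
    \<open>X\<close>.\<close>
  define W where "W = (1/2) *\<^sub>R (X ** Q)"
  define ad where "ad Y = W ** Y - Y ** W" for Y
  define D where "D m t = matrix_exp W t ** (ad ^^ m) Q ** transpose (matrix_exp W t)" for m t
  have QX: "Q ** X = - (X ** Q)"
    using anti by (simp add: add_eq_0_iff)
  have Qsym: "transpose Q = Q"
    using Q by (simp add: Gr_def)
  have skew: "transpose W = - W"
    by (simp add: W_def transpose_scalar matrix_transpose_mul sym Qsym QX)
  have "W ** Q = (1/2) *\<^sub>R (X ** (Q ** Q))"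
    by (simp add: W_def matrix_mult.scaleR_left matrix_mul_assoc)
  moreover have "Q ** W = - ((1/2) *\<^sub>R (X ** (Q ** Q)))"
    by (simp add: W_def matrix_mult.scaleR_right matrix_mul_assoc QX matrix_mult.minus_left)
  ultimately have adQ: "ad Q = X"
    by (simp add: ad_def Gr_square[OF Q] scaleR_2 [symmetric])
  \<comment> \<open>The product rule yields \<open>W ** Y + Y ** transpose W\<close> between the
    exponentials, which is \<open>ad Y\<close> by skewness.\<close>
  have D: "(D m has_vector_derivative D (Suc m) t) (at t)" for m t
  proof -
    let ?E = "matrix_exp W" and ?Y = "(ad ^^ m) Q"
    note dE = matrix_exp_has_vector_derivative[of W t]
    have "((\<lambda>t. ?E t ** ?Y) has_vector_derivative ?E t ** W ** ?Y) (at t)"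
      by (rule bounded_linear.has_vector_derivative[OF matrix_mult.bounded_linear_left dE])
    from matrix_mult.has_vector_derivative[OF this transpose_has_vector_derivative[OF dE]]
    show ?thesis
      by (simp add: D_def [abs_def] ad_def matrix_transpose_mul skew matrix_mult.minus_left
          matrix_mult.minus_right matrix_mult.diff_left matrix_mult.diff_right matrix_mul_assoc)
  qed
  have D0: "D m 0 = (ad ^^ m) Q" for m
    by (simp add: D_def matrix_exp_0 transpose_mat)
  have "D 0 t \<in> Gr k" for t
    using Gr_conjugate_orthogonal[OF skew_matrix_exp_orthogonal[OF skew] Q] by (simp add: D_def)
  then have "smooth_curve_through (Gr k) Q (D 0)"
    unfolding smooth_curve_through_def using D D0[of 0]
    by (auto intro!: exI[of _ "1::real"] exI[of _ D])
  moreover have "vector_derivative (D 0) (at 0) = X"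
    using vector_derivative_at[OF D[of 0 0]] D0[of 1] adQ by simp
  ultimately show thesis
    by (rule that)
qed

lemma tangent_space_Gr:
  fixes Q :: "real^'n^'n"
  assumes "Q \<in> Gr k"
  shows "tangent_space (Gr k) Q = {X. transpose X = X \<and> Q ** X + X ** Q = 0}"
proof (intro equalityI subsetI)
  fix X assume "X \<in> tangent_space (Gr k) Q"
  then show "X \<in> {X. transpose X = X \<and> Q ** X + X ** Q = 0}"
    unfolding tangent_space_def using Gr_velocity(2,3)[OF _ refl] by blast
next
  fix X assume "X \<in> {X. transpose X = X \<and> Q ** X + X ** Q = 0}"
  then show "X \<in> tangent_space (Gr k) Q"
    unfolding tangent_space_def using Gr_curve_exists[OF assms, of X] by blast
qed

subsection \<open>The Riemannian gradient\<close>

lemma is_riemannian_gradient_Gr_unique: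
  fixes Q :: "real^'n^'n"
  assumes Q: "Q \<in> Gr k"
    and G: "is_riemannian_gradient (Gr k) Gr_metric f Q G"
    and H: "is_riemannian_gradient (Gr k) Gr_metric f Q H"
  shows "G = H"
proof -
  define X where "X = G - H"
  have "Q ** X + X ** Q = (Q ** G + G ** Q) - (Q ** H + H ** Q)"
    by (simp add: X_def matrix_mult.diff_left matrix_mult.diff_right)
  then have "transpose X = X" "Q ** X + X ** Q = 0"
    using G H
    by (auto simp: is_riemannian_gradient_def tangent_space_Gr[OF Q] X_def transpose_diff)
  \<comment> \<open>The difference \<open>X\<close> is again tangent, so some curve has velocity
    \<open>X\<close>; the derivative of \<open>f\<close> along it is both
    \<open>trace (G ** X)\<close> and \<open>trace (H ** X)\<close>.\<close>
  moreover from Gr_curve_exists[OF Q this] obtain \<gamma>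
    where \<gamma>: "smooth_curve_through (Gr k) Q \<gamma>" "vector_derivative \<gamma> (at 0) = X" .
  have "trace (G ** X) = trace (H ** X)"
    using G H \<gamma> DERIV_unique unfolding is_riemannian_gradient_def Gr_metric_def by metis
  then have "trace (X ** X) = 0"
    by (simp add: X_def matrix_mult.diff_left trace_sub)
  ultimately show ?thesis
    using symmetric_eq_0_if_trace_square[of X] by (simp add: X_def)
qed

text \<open>Expand \<open>Y\<close> in matrix units and use linearity of \<open>f'\<close>; its
  value at a unit is a partial derivative by the chain rule along a line through
  \<open>Q\<close>.\<close>

lemma has_derivative_partial_deriv_matrix:
  fixes Q :: "real^'n^'n"
  assumes f: "(f has_derivative f') (at Q)"
  shows "f' Y = trace (transpose (partial_deriv_matrix f Q) ** Y)"
proof -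
  have f': "linear f'"
    using f by (rule has_derivative_linear)
  have partial: "partial_deriv_matrix f Q $ i $ j = f' (axis i (axis j 1))" for i j
  proof -
    let ?e = "axis i (axis j 1) :: real^'n^'n"
    have "((\<lambda>t. Q + t *\<^sub>R ?e) has_vector_derivative ?e) (at 0)"
      by (auto intro!: derivative_eq_intros)
    then have "((\<lambda>t. f (Q + t *\<^sub>R ?e)) has_real_derivative f' ?e) (at 0)"
      unfolding has_real_derivative_iff_has_vector_derivative
      using vector_derivative_diff_chain_within[of "\<lambda>t. Q + t *\<^sub>R ?e" ?e 0 UNIV f f']
        has_derivative_at_withinI[OF f] by (simp add: o_def)
    then show ?thesis
      by (simp add: partial_deriv_matrix_def DERIV_imp_deriv)
  qed
  \<comment> \<open>The inner sum of the expansion below carries a condition on the outer index;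
    pulling it out lets both sums collapse.\<close>
  have [simp]: "(\<Sum>x\<in>A. if P then g x else 0) = (if P then sum g A else 0)"
    for A :: "'n set" and P and g :: "'n \<Rightarrow> real"
    by simp
  have "Y = (\<Sum>i\<in>UNIV. \<Sum>j\<in>UNIV. Y $ i $ j *\<^sub>R axis i (axis j 1))"
    by (simp add: vec_eq_iff axis_def if_distrib[of "\<lambda>x. x $ _"] if_distrib[of "\<lambda>x. _ * x"]
        cong: if_cong)
  then have "f' Y = f' (\<Sum>i\<in>UNIV. \<Sum>j\<in>UNIV. Y $ i $ j *\<^sub>R axis i (axis j 1))"
    by simp
  then show ?thesis
    by (simp add: trace_transpose_mult partial linear_sum [OF f'] linear_scale [OF f'] mult.commute)
qed

lemma is_riemannian_gradient_Gr:
  fixes Q :: "real^'n^'n"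
  assumes Q: "Q \<in> Gr k" and f: "(f has_derivative f') (at Q)"
    and S: "S = partial_deriv_matrix f Q + transpose (partial_deriv_matrix f Q)"
  shows "is_riemannian_gradient (Gr k) Gr_metric f Q ((1/4) *\<^sub>R (S - Q ** S ** Q))"
    (is "is_riemannian_gradient _ _ _ _ ?G")
proof -
  let ?F = "partial_deriv_matrix f Q"
  have Qsym: "transpose Q = Q"
    using Q by (simp add: Gr_def)
  note QQ = Gr_square[OF Q]
  have Ssym: "transpose S = S"
    by (simp add: S transpose_add add.commute)
  \<comment> \<open>Hence \<open>Q ** ?G\<close> and \<open>?G ** Q\<close> are
    \<open>(Q ** S - S ** Q) / 4\<close> and its negative, which gives tangency.\<close>
  have "Q ** (Q ** S ** Q) = S ** Q" "Q ** S ** Q ** Q = Q ** S"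
    using QQ by (metis matrix_mul_assoc matrix_mul_lid, metis matrix_mul_assoc matrix_mul_rid)
  then have "?G \<in> tangent_space (Gr k) Q"
    by (simp add: tangent_space_Gr[OF Q] transpose_scalar transpose_diff matrix_transpose_mul
        Qsym Ssym matrix_mul_assoc matrix_mult.scaleR_left matrix_mult.scaleR_right
        matrix_mult.diff_left matrix_mult.diff_right scaleR_add_right [symmetric])
  moreover have "((\<lambda>t. f (\<gamma> t)) has_real_derivative Gr_metric Q ?G (vector_derivative \<gamma> (at 0)))
      (at 0)" if \<gamma>: "smooth_curve_through (Gr k) Q \<gamma>" for \<gamma>
  proof -
    define Y where "Y = vector_derivative \<gamma> (at 0)"
    note Y = Gr_velocity[OF \<gamma> Y_def]
    have "\<gamma> 0 = Q"
      using \<gamma> by (simp add: smooth_curve_through_def)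
    then have df: "((\<lambda>t. f (\<gamma> t)) has_real_derivative f' Y) (at 0)"
      unfolding has_real_derivative_iff_has_vector_derivative
      using vector_derivative_diff_chain_within[of \<gamma> Y 0 UNIV f f'] Y(1)
        has_derivative_at_withinI[OF f] by (simp add: o_def)
    have "Q ** Y ** Q = - Y"
    proof -
      have "Q ** Y ** Q = - (Y ** Q) ** Q"
        using Y(3) by (simp add: add_eq_0_iff2)
      then show ?thesis
        by (simp add: matrix_mult.minus_left QQ flip: matrix_mul_assoc)
    qed
    \<comment> \<open>Cyclicity of the trace moves the outer \<open>Q\<close> next to
      \<open>Y\<close>. The two terms of \<open>?G\<close> thus contribute equally.\<close>
    then have "trace (Q ** S ** Q ** Y) = - trace (S ** Y)"
      using trace_mul_sym[of Q "S ** Q ** Y"] trace_minus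
      by (simp add: matrix_mult.minus_right flip: matrix_mul_assoc)
    \<comment> \<open>As \<open>Y\<close> is symmetric, both summands of \<open>S\<close> pair
      equally with it; this second doubling cancels the factor 1/4.\<close>
    moreover have "trace (?F ** Y) = trace (transpose ?F ** Y)"
      using trace_transpose[of "?F ** Y"] trace_mul_sym[of Y "transpose ?F"]
      by (simp add: matrix_transpose_mul Y)
    ultimately have "Gr_metric Q ?G Y = trace (transpose ?F ** Y)"
      by (simp add: Gr_metric_def matrix_mult.scaleR_left matrix_mult.diff_left trace_scaleR
          trace_sub S matrix_mult.add_left trace_add)
    then show ?thesis
      using df has_derivative_partial_deriv_matrix[OF f, of Y] by (simp add: Y_def)
  qed
  ultimately show ?thesis
    by (simp add: is_riemannian_gradient_def)
qed

subsection \<open>Block matrices\<close>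

lemma index_pos_less: "index_pos (i :: 'n::{finite,linorder}) < CARD('n)"
  unfolding index_pos_def by (rule psubset_card_mono) auto

text \<open>Initial segments grow strictly along a linear order, so positions determine
  indices.\<close>

lemma index_pos_eq_iff: "index_pos i = index_pos j \<longleftrightarrow> i = j"
proof (rule linorder_cases[of i j])
  have *: "index_pos a < index_pos b" if "a < b" for a b :: 'a
    unfolding index_pos_def by (rule psubset_card_mono) (use that in auto)
  show ?thesis if "i < j" using *[OF that] that by auto
  show ?thesis if "j < i" using *[OF that] that by auto
qed simp

lemma signature_matrix_entry:
  assumes "k \<le> CARD('n)"
  shows "(signature_matrix k :: ('n::{finite,linorder}) sq_matrix) $ i $ j =
    (if i = j then if index_pos i < k then 1 else -1 else 0)"
  using assms index_pos_less[of i] index_pos_less[of j]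
  by (auto simp: signature_matrix_def cart_of_mat_def Let_def
      simp flip: index_pos_eq_iff)

text \<open>Conjugation multiplies each entry by the signs of its row and column, which differ
  exactly in the off-diagonal blocks.\<close>

lemma signature_conjugate_entry:
  fixes M :: "('n::{finite,linorder}) sq_matrix"
  assumes "k \<le> CARD('n)"
  shows "(signature_matrix k ** M ** signature_matrix k) $ i $ j =
    (if index_pos i < k \<longleftrightarrow> index_pos j < k then M $ i $ j else - M $ i $ j)"
  using assms
  by (simp add: matrix_matrix_mult_def signature_matrix_entry if_distrib[of "\<lambda>x. _ * x"]
      if_distrib[of "\<lambda>x. x * _"] cong: if_cong)

text \<open>Subtracting the conjugate cancels the diagonal blocks and doubles the others. The
  resulting formula is free of blocks and can be conjugated by \<open>V\<close>.\<close>

lemma off_diagonal_blocks: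
  fixes M :: "('n::{finite,linorder}) sq_matrix"
  assumes k: "k \<le> CARD('n)"
    and carrier: "A \<in> carrier_mat k k" "B \<in> carrier_mat k (CARD('n) - k)"
      "C \<in> carrier_mat (CARD('n) - k) (CARD('n) - k)"
    and M: "M = cart_of_mat (four_block_mat A B (transpose_mat B) C)"
  shows "cart_of_mat (four_block_mat (0\<^sub>m k k) B (transpose_mat B)
        (0\<^sub>m (CARD('n) - k) (CARD('n) - k)))
      = (1/2) *\<^sub>R (M - signature_matrix k ** M ** signature_matrix k)" (is "?N = _")
proof -
  have "?N $ i $ j = (1/2) * (M $ i $ j - (signature_matrix k ** M ** signature_matrix k) $ i $ j)"
    for i j
    using k carrier index_pos_less[of i] index_pos_less[of j]
    unfolding signature_conjugate_entry[OF k] M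
    by (auto simp: cart_of_mat_def)
  then show ?thesis
    by (simp add: vec_eq_iff)
qed

section \<open>The gradient in block form\<close>

theorem corollary5p3:
  fixes f :: "('n::{finite,linorder}) sq_matrix \<Rightarrow> real"
    and U :: "('n sq_matrix) set"
    and Q V :: "'n sq_matrix"
    and k :: nat
    and A B C :: "real mat"
  assumes "1 \<le> k" and "k \<le> CARD('n)"
    and "open U" and "Gr k \<subseteq> U" and "continuously_differentiable_on f U"
    and "orthogonal_matrix V"
    and "Q = V ** signature_matrix k ** transpose V" and "Q \<in> Gr k"
    and "A \<in> carrier_mat k k"
    and "B \<in> carrier_mat k (CARD('n) - k)"
    and "C \<in> carrier_mat (CARD('n) - k) (CARD('n) - k)"
    and "transpose V
           ** (partial_deriv_matrix f Q
                + transpose (partial_deriv_matrix f Q)) ** V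
         = cart_of_mat (four_block_mat A B (transpose_mat B) C)"
  shows "\<forall>G. is_riemannian_gradient (Gr k) Gr_metric f Q G \<longleftrightarrow>
    G = (1/2) *\<^sub>R
      (V ** cart_of_mat (four_block_mat (0\<^sub>m k k) B
                           (transpose_mat B) (0\<^sub>m (CARD('n) - k) (CARD('n) - k)))
         ** transpose V)"
proof (intro allI)
  fix G
  let ?S = "partial_deriv_matrix f Q + transpose (partial_deriv_matrix f Q)"
  let ?J = "signature_matrix k :: 'n sq_matrix"
  let ?N = "cart_of_mat (four_block_mat (0\<^sub>m k k) B
      (transpose_mat B) (0\<^sub>m (CARD('n) - k) (CARD('n) - k))) :: 'n sq_matrix"
  have VV: "V ** transpose V = Finite_Cartesian_Product.mat 1"
    using assms(6) by (simp add: orthogonal_matrix_def)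
  have V: "V ** (transpose V ** X) = X" "X ** V ** transpose V = X" for X
    using VV by (metis matrix_mul_assoc matrix_mul_lid, metis matrix_mul_assoc matrix_mul_rid)
  have "?N = (1/2) *\<^sub>R (transpose V ** ?S ** V - ?J ** (transpose V ** ?S ** V) ** ?J)"
    by (rule off_diagonal_blocks[OF assms(2,9-12)])
  then have "V ** ?N ** transpose V = (1/2) *\<^sub>R (V ** (transpose V ** ?S ** V) ** transpose V
      - V ** (?J ** (transpose V ** ?S ** V) ** ?J) ** transpose V)"
    by (simp only: matrix_mult.scaleR_left matrix_mult.scaleR_right matrix_mult.diff_left
        matrix_mult.diff_right)
  also have "V ** (transpose V ** ?S ** V) ** transpose V = ?S"
    using V by (metis matrix_mul_assoc)
  also have "V ** (?J ** (transpose V ** ?S ** V) ** ?J) ** transpose V = Q ** ?S ** Q"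
    by (simp only: assms(7) matrix_mul_assoc)
  \<comment> \<open>One factor 1/2 is that of the claimed formula, the other comes from extracting
    the off-diagonal blocks.\<close>
  finally have N: "(1/2) *\<^sub>R (V ** ?N ** transpose V) = (1/4) *\<^sub>R (?S - Q ** ?S ** Q)"
    by simp
  obtain f' where "(f has_derivative f') (at Q)"
    using assms(4,5,8) unfolding continuously_differentiable_on_def by blast
  from is_riemannian_gradient_Gr[OF assms(8) this refl]
    is_riemannian_gradient_Gr_unique[OF assms(8)]
  show "is_riemannian_gradient (Gr k) Gr_metric f Q G \<longleftrightarrow>
      G = (1/2) *\<^sub>R (V ** ?N ** transpose V)"
    unfolding N by blast
qed

end
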